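(* Let $Z$ be a Banach space over $\mathbb{K}$, let $u\in S_Z$, and let $\Lambda\subset B_{Z^*}$ be one-norming for $Z$. Then, for every $z\in Z$, \begin{align*} V(Z,u,z)&=\operatorname{conv}\bigl(\{\theta_0\lim\psi_n(z)\colon \psi_n\in\Lambda\ \forall n\in\mathbb{N},\ \lim\psi_n(u)=\overline{\theta_0},\ \theta_0\in\mathbb{T}\}\bigr)\\ &=\operatorname{conv}\bigl(\{\lim\psi_n(z)\overline{\psi_n(u)}\colon \psi_n\in\Lambda\ \forall n\in\mathbb{N},\ \lim|\psi_n(u)|=1\}\bigr)\\ &=\operatorname{conv}\Bigl(\bigcap_{\delta>0}\overline{\{\psi(z)\overline{\psi(u)}\colon \psi\in\Lambda,\ |\psi(u)|>1-\delta\}}\Bigr)\\ &=\bigcap_{\delta>0}\operatorname{conv}\Bigl(\overline{\{\psi(z)\overline{\psi(u)}\colon \psi\in\Lambda,\ |\psi(u)|>1-\delta\}}\Bigr). \end{align*}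
   Context: $\mathbb{K}$ is $\mathbb{R}$ or $\mathbb{C}$, $\mathbb{T}$ is the set of modulus-one scalars of $\mathbb{K}$. $B_Z$ and $S_Z$ are the closed unit ball and unit sphere of $Z$, $Z^*$ is the topological dual. For $u\in S_Z$ and $z\in Z$, the abstract numerical range is $V(Z,u,z):=\{\phi(z)\colon \phi\in S_{Z^*},\ \phi(u)=1\}\subset\mathbb{K}$. A subset $\Lambda\subset B_{Z^*}$ is one-norming for $Z$ if $\|z\|=\sup\{|\phi(z)|\colon \phi\in\Lambda\}$ for all $z\in Z$. $\operatorname{conv}$ is the convex hull; a bar over a set of scalars is its closure, and a bar over a scalar is complex conjugation. Writing $\lim a_n$ for a bounded scalar sequence means that the sequence is required to be convergent. *)

theory Defs
  imports "HOL-Analysis.Analysis"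
begin

text \<open>
  The scalar field is \<open>\<real>\<close> or \<open>\<complex>\<close>: the axioms of the following class say that
  \<open>'a = \<real>\<close> (case \<open>rc_i = 0\<close>) or \<open>'a = \<real> + \<real> i\<close> with \<open>i\<^sup>2 = -1\<close>, with the usual
  conjugation, modulus and Euclidean topology.
\<close>

class rc_field = real_normed_field + euclidean_space +
  fixes rc_i :: 'a
    and rc_cnj :: "'a \<Rightarrow> 'a"
  assumes rc_i_cases: "rc_i = 0 \<or> rc_i * rc_i = - 1"
    and rc_decomp: "\<exists>a b. z = a *\<^sub>R 1 + b *\<^sub>R rc_i"
    and rc_cnj_decomp: "rc_cnj (a *\<^sub>R 1 + b *\<^sub>R rc_i) = a *\<^sub>R 1 - b *\<^sub>R rc_i"
    and rc_mult_cnj: "z * rc_cnj z = (norm z)\<^sup>2 *\<^sub>R 1"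

instantiation real :: rc_field
begin

definition rc_i_real :: real where "rc_i_real = 0"
definition rc_cnj_real :: "real \<Rightarrow> real" where "rc_cnj_real x = x"

instance
  by standard (auto simp: rc_i_real_def rc_cnj_real_def power2_eq_square)

end

instantiation complex :: rc_field
begin

definition rc_i_complex :: complex where "rc_i_complex = \<i>"
definition rc_cnj_complex :: "complex \<Rightarrow> complex" where "rc_cnj_complex = cnj"

instance
proof
  fix z :: complex and a b :: real
  show "(rc_i :: complex) = 0 \<or> rc_i * rc_i = (- 1 :: complex)"
    by (simp add: rc_i_complex_def)
  have "z = Re z *\<^sub>R 1 + Im z *\<^sub>R rc_i"
    by (simp add: rc_i_complex_def complex_eq_iff)
  then show "\<exists>a b. z = a *\<^sub>R 1 + b *\<^sub>R rc_i"
    by blast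
  show "rc_cnj (a *\<^sub>R 1 + b *\<^sub>R rc_i) = (a *\<^sub>R 1 - b *\<^sub>R rc_i :: complex)"
    by (simp add: rc_i_complex_def rc_cnj_complex_def complex_eq_iff)
  show "z * rc_cnj z = (norm z)\<^sup>2 *\<^sub>R 1"
    by (simp only: rc_cnj_complex_def complex_norm_square[symmetric] scaleR_conv_of_real mult_1_right)
qed

end

text \<open>
  A Banach space over the scalar field \<open>'k\<close>. The class \<^class>\<open>banach\<close> provides the norm and the
  underlying real Banach space structure, which \<open>smul\<close> extends to scalars in \<open>'k\<close>.
\<close>

locale banach_over = vector_space smul
  for smul :: "'k::rc_field \<Rightarrow> 'z::banach \<Rightarrow> 'z" +
  assumes smul_of_real: "smul (of_real r) x = r *\<^sub>R x"
    and norm_smul: "norm (smul c x) = norm c * norm x"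

definition dual_space :: "('k::rc_field \<Rightarrow> 'z::banach \<Rightarrow> 'z) \<Rightarrow> ('z \<Rightarrow> 'k) set" where
  "dual_space smul = {\<phi>. Vector_Spaces.linear smul (*) \<phi> \<and> bounded_linear \<phi>}"

definition dual_ball :: "('k::rc_field \<Rightarrow> 'z::banach \<Rightarrow> 'z) \<Rightarrow> ('z \<Rightarrow> 'k) set" where
  "dual_ball smul = {\<phi> \<in> dual_space smul. onorm \<phi> \<le> 1}"

definition dual_sphere :: "('k::rc_field \<Rightarrow> 'z::banach \<Rightarrow> 'z) \<Rightarrow> ('z \<Rightarrow> 'k) set" where
  "dual_sphere smul = {\<phi> \<in> dual_space smul. onorm \<phi> = 1}"

definition abstract_numerical_range ::
    "('k::rc_field \<Rightarrow> 'z::banach \<Rightarrow> 'z) \<Rightarrow> 'z \<Rightarrow> 'z \<Rightarrow> 'k set" where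
  "abstract_numerical_range smul u z = {\<phi> z |\<phi>. \<phi> \<in> dual_sphere smul \<and> \<phi> u = 1}"

text \<open>
  The supremum is that of the type \<^typ>\<open>real\<close>. It is taken over a set bounded by \<open>norm z\<close>; for
  \<open>\<Lambda> = {}\<close> it is an unspecified constant independent of \<open>z\<close>, so a one-norming set of a nonzero
  space is nonempty.
\<close>

definition one_norming :: "('k::rc_field \<Rightarrow> 'z::banach \<Rightarrow> 'z) \<Rightarrow> ('z \<Rightarrow> 'k) set \<Rightarrow> bool" where
  "one_norming smul \<Lambda> \<longleftrightarrow>
     \<Lambda> \<subseteq> dual_ball smul \<and> (\<forall>z. norm z = (SUP \<phi>\<in>\<Lambda>. norm (\<phi> z)))"

end

theory Submission
  imports Defs
begin

text \<open>
  Let \<open>A\<^sub>\<delta>\<close> be the closure of \<open>{\<psi>(z) cnj (\<psi>(u)) | \<psi> \<in> \<Lambda>, |\<psi>(u)| > 1 - \<delta>}\<close>,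
  let \<open>A\<close> be the intersection of
  the \<open>A\<^sub>\<delta>\<close> and let \<open>V\<close> be the numerical range. Sequential compactness of balls in the scalar
  field identifies both sets of limits with \<open>A\<close>, so it suffices to show
  \<open>V \<subseteq> conv A \<subseteq> \<Inter>\<^sub>\<delta> conv A\<^sub>\<delta> \<subseteq> V\<close>.
  For the first inclusion, separate a point outside \<open>conv A\<close>. For \<open>\<phi>(u) = 1 = \<parallel>\<phi>\<parallel>\<close> and small
  \<open>t > 0\<close>, one has \<open>\<parallel>u + t w\<parallel> \<ge> 1 + t Re \<phi>(w)\<close>; any \<open>\<psi> \<in> \<Lambda>\<close> that nearly attains this norm has
  \<open>|\<psi>(u)|\<close> close to 1, and expanding \<open>|\<psi>(u + t w)|\<^sup>2\<close> to first order in \<open>t\<close> gives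
  \<open>Re \<phi>(w) \<le> Re (\<psi>(w) cnj (\<psi>(u))) + O(t)\<close>.
  For the last one, \<open>\<psi>(z) cnj (\<psi>(u))\<close> is the value at \<open>z\<close> of the functional \<open>cnj (\<psi>(u)) \<psi>\<close> of the
  dual ball, whose value at \<open>u\<close> is close to 1; by the Banach--Alaoglu theorem the pairs
  \<open>(f(u), f(z))\<close>, for \<open>f\<close> in the dual ball, form a compact convex set.
\<close>

section \<open>Conjugation and the inner product of the scalar field\<close>

lemma rc_cnj_linear: "linear (rc_cnj :: 'k::rc_field \<Rightarrow> 'k)"
proof
  fix x y :: 'k and r :: real
  obtain a b c d where xy: "x = a *\<^sub>R 1 + b *\<^sub>R rc_i" "y = c *\<^sub>R 1 + d *\<^sub>R rc_i"
    using rc_decomp by metis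
  have "x + y = (a + c) *\<^sub>R 1 + (b + d) *\<^sub>R rc_i" "r *\<^sub>R x = (r * a) *\<^sub>R 1 + (r * b) *\<^sub>R rc_i"
    by (simp_all add: xy algebra_simps)
  then show "rc_cnj (x + y) = rc_cnj x + rc_cnj y" "rc_cnj (r *\<^sub>R x) = r *\<^sub>R rc_cnj x"
    by (simp_all only: rc_cnj_decomp) (simp_all add: xy rc_cnj_decomp algebra_simps)
qed

lemma rc_cnj_cnj [simp]: "rc_cnj (rc_cnj x) = (x :: 'k::rc_field)"
proof -
  obtain a b where x: "x = a *\<^sub>R 1 + b *\<^sub>R rc_i"
    using rc_decomp by metis
  have "rc_cnj x = a *\<^sub>R 1 + (- b) *\<^sub>R rc_i"
    by (simp add: x rc_cnj_decomp)
  then show ?thesis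
    by (simp only: rc_cnj_decomp) (simp add: x)
qed

lemma norm_rc_cnj [simp]: "norm (rc_cnj x) = norm (x :: 'k::rc_field)"
proof (cases "x = 0")
  case True
  then show ?thesis by (simp add: linear_0[OF rc_cnj_linear])
next
  case False
  have "norm x * norm (rc_cnj x) = norm x * norm x"
    using arg_cong[OF rc_mult_cnj[of x], of norm] by (simp add: norm_mult power2_eq_square)
  with False show ?thesis by simp
qed

lemma tendsto_rc_cnj [tendsto_intros]:
  "(f \<longlongrightarrow> l) F \<Longrightarrow> ((\<lambda>x. rc_cnj (f x)) \<longlongrightarrow> rc_cnj (l :: 'k::rc_field)) F"
  using linear_conv_bounded_linear rc_cnj_linear bounded_linear.tendsto by blast

text \<open>Polarization writes \<open>inner\<close> through norms, and the norm is
  multiplicative.\<close>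

lemma inner_mult_mult_left: "inner (c * x) (c * y) = (norm c)\<^sup>2 * inner x (y :: 'k::rc_field)"
  by (simp add: dot_norm norm_mult power_mult_distrib flip: distrib_left) (simp add: algebra_simps)

text \<open>Multiplying both arguments of the right-hand side by \<open>rc_cnj y\<close> scales it
  by the square of \<open>norm y\<close> and turns \<open>y * w\<close> into a real multiple of
  \<open>w\<close>. This adjoint relation lets \<open>inner\<close> do the work of real parts, with
  \<open>inner 1 c\<close> as the real part of \<open>c\<close>.\<close>

lemma inner_mult_rc_cnj: "inner (x * rc_cnj y) w = inner x (y * (w :: 'k::rc_field))"
proof (cases "y = 0")
  case True
  then show ?thesis by (simp add: linear_0[OF rc_cnj_linear])
next
  case False
  have "(norm y)\<^sup>2 * inner x (y * w) = inner (rc_cnj y * x) (rc_cnj y * (y * w))"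
    by (simp add: inner_mult_mult_left)
  also have "rc_cnj y * (y * w) = (norm y)\<^sup>2 *\<^sub>R w"
    using arg_cong[OF rc_mult_cnj[of y], of "\<lambda>c. c * w"] by (simp add: ac_simps)
  finally show ?thesis
    using False by (simp add: mult.commute)
qed

section \<open>Sets of limits and their elementary inclusions\<close>

definition near_values ::
    "('z \<Rightarrow> 'k::rc_field) set \<Rightarrow> 'z \<Rightarrow> 'z \<Rightarrow> real \<Rightarrow> 'k set" where
  "near_values \<Lambda> u z \<delta> = {\<psi> z * rc_cnj (\<psi> u) |\<psi>. \<psi> \<in> \<Lambda> \<and> norm (\<psi> u) > 1 - \<delta>}"

definition limit_values ::
    "('z \<Rightarrow> 'k::rc_field) set \<Rightarrow> 'z \<Rightarrow> 'z \<Rightarrow> 'k set" where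
  "limit_values \<Lambda> u z = {l. \<exists>\<psi>::nat \<Rightarrow> 'z \<Rightarrow> 'k. (\<forall>n. \<psi> n \<in> \<Lambda>) \<and>
     (\<lambda>n. norm (\<psi> n u)) \<longlonglongrightarrow> 1 \<and> (\<lambda>n. \<psi> n z * rc_cnj (\<psi> n u)) \<longlonglongrightarrow> l}"

definition rotated_limit_values ::
    "('z \<Rightarrow> 'k::rc_field) set \<Rightarrow> 'z \<Rightarrow> 'z \<Rightarrow> 'k set" where
  "rotated_limit_values \<Lambda> u z = {\<theta> * l |\<theta> l. norm \<theta> = 1 \<and>
     (\<exists>\<psi>::nat \<Rightarrow> 'z \<Rightarrow> 'k. (\<forall>n. \<psi> n \<in> \<Lambda>) \<and>
       (\<lambda>n. \<psi> n u) \<longlonglongrightarrow> rc_cnj \<theta> \<and> (\<lambda>n. \<psi> n z) \<longlonglongrightarrow> l)}"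

text \<open>Limits of both factors determine the limit of the product. The way back, in
  \<open>limit_values_eq\<close>, needs compactness.\<close>

lemma rotated_limit_values_subset: "rotated_limit_values \<Lambda> u z \<subseteq> limit_values \<Lambda> u z"
proof
  fix x
  assume "x \<in> rotated_limit_values \<Lambda> u z"
  then obtain \<theta> l \<psi> where x: "x = \<theta> * l" "norm \<theta> = 1" "\<forall>n::nat. \<psi> n \<in> \<Lambda>"
    and lim: "(\<lambda>n. \<psi> n u) \<longlonglongrightarrow> rc_cnj \<theta>" "(\<lambda>n. \<psi> n z) \<longlonglongrightarrow> l"
    unfolding rotated_limit_values_def by blast
  have "(\<lambda>n. norm (\<psi> n u)) \<longlonglongrightarrow> 1"
    using tendsto_norm[OF lim(1)] x(2) by simp
  moreover have "(\<lambda>n. \<psi> n z * rc_cnj (\<psi> n u)) \<longlonglongrightarrow> x"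
    using tendsto_mult[OF lim(2) tendsto_rc_cnj[OF lim(1)]] x(1) by (simp add: mult.commute)
  ultimately show "x \<in> limit_values \<Lambda> u z"
    using x(3) unfolding limit_values_def by blast
qed

lemma limit_values_subset: "limit_values \<Lambda> u z \<subseteq> (\<Inter>\<delta>\<in>{0<..}. closure (near_values \<Lambda> u z \<delta>))"
proof (intro subsetI INT_I)
  fix x and \<delta> :: real
  assume "x \<in> limit_values \<Lambda> u z" and "\<delta> \<in> {0<..}"
  then obtain \<psi> where \<psi>: "\<forall>n::nat. \<psi> n \<in> \<Lambda>" "(\<lambda>n. norm (\<psi> n u)) \<longlonglongrightarrow> 1"
    "(\<lambda>n. \<psi> n z * rc_cnj (\<psi> n u)) \<longlonglongrightarrow> x" and "\<delta> > 0"
    unfolding limit_values_def by auto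
  have "\<forall>\<^sub>F n in sequentially. norm (\<psi> n u) > 1 - \<delta>"
    using order_tendstoD(1)[OF \<psi>(2), of "1 - \<delta>"] \<open>\<delta> > 0\<close> by simp
  then have "\<forall>\<^sub>F n in sequentially. \<psi> n z * rc_cnj (\<psi> n u) \<in> closure (near_values \<Lambda> u z \<delta>)"
    by (rule eventually_mono)
      (use \<psi>(1) in \<open>auto simp: near_values_def intro!: subsetD[OF closure_subset]\<close>)
  then show "x \<in> closure (near_values \<Lambda> u z \<delta>)"
    using Lim_in_closed_set[OF closed_closure _ sequentially_bot \<psi>(3)] by blast
qed

context banach_over
begin

section \<open>The dual unit ball and its weak-star compactness\<close>

text \<open>Trading \<open>onorm\<close> for pointwise inequalities shows the ball as a product of
  compact balls cut by pointwise closed conditions, which is the form that the compactness proof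
  uses.\<close>

lemma dual_ball_iff:
  "f \<in> dual_ball smul \<longleftrightarrow>
     (\<forall>x y. f (x + y) = f x + f y) \<and> (\<forall>c x. f (smul c x) = c * f x) \<and> (\<forall>x. norm (f x) \<le> norm x)"
    (is "_ \<longleftrightarrow> ?add \<and> ?scale \<and> ?bound")
proof
  assume "f \<in> dual_ball smul"
  then have lin: "Vector_Spaces.linear smul (*) f" and bl: "bounded_linear f" and "onorm f \<le> 1"
    by (auto simp: dual_ball_def dual_space_def)
  have ?bound
  proof
    fix x
    have "norm (f x) \<le> onorm f * norm x"
      by (rule onorm[OF bl])
    also have "\<dots> \<le> 1 * norm x"
      using \<open>onorm f \<le> 1\<close> by (intro mult_right_mono) auto
    finally show "norm (f x) \<le> norm x" by simp
  qed
  with lin show "?add \<and> ?scale \<and> ?bound"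
    unfolding Vector_Spaces.linear_iff by blast
next
  assume f: "?add \<and> ?scale \<and> ?bound"
  then have "Vector_Spaces.linear smul (*) f"
    unfolding Vector_Spaces.linear_iff
    using vector_space_axioms vector_space_over_itself.vector_space_axioms by blast
  moreover have "f (r *\<^sub>R x) = r *\<^sub>R f x" for r x
    using f by (metis smul_of_real scaleR_conv_of_real)
  then have "bounded_linear f"
    using f by (intro bounded_linear_intro[where K = 1]) auto
  moreover have "onorm f \<le> 1"
    using f by (intro onorm_bound) auto
  ultimately show "f \<in> dual_ball smul"
    by (simp add: dual_ball_def dual_space_def)
qed

lemma dual_ball_add: "f \<in> dual_ball smul \<Longrightarrow> f (x + y) = f x + f y"
  and dual_ball_smul: "f \<in> dual_ball smul \<Longrightarrow> f (smul c x) = c * f x"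
  and dual_ball_norm_le: "f \<in> dual_ball smul \<Longrightarrow> norm (f x) \<le> norm x"
  by (auto simp: dual_ball_iff)

lemma dual_ball_scaleR: "f \<in> dual_ball smul \<Longrightarrow> f (r *\<^sub>R x) = r *\<^sub>R f x"
  by (metis dual_ball_smul smul_of_real scaleR_conv_of_real)

lemma dual_ball_scaled:
  assumes "f \<in> dual_ball smul" and "norm c \<le> 1"
  shows "(\<lambda>x. c * f x) \<in> dual_ball smul"
proof -
  have "norm c * norm (f x) \<le> norm x" for x
    using mult_mono[OF assms(2) dual_ball_norm_le[OF assms(1), of x]] by simp
  with assms(1) show ?thesis
    by (simp add: dual_ball_iff algebra_simps norm_mult)
qed

lemma dual_ball_convex_combination:
  assumes "f \<in> dual_ball smul" "g \<in> dual_ball smul" "a \<ge> 0" "b \<ge> 0" "a + b = 1"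
  shows "(\<lambda>x. a *\<^sub>R f x + b *\<^sub>R g x) \<in> dual_ball smul"
proof -
  have "norm (a *\<^sub>R f x + b *\<^sub>R g x) \<le> norm x" for x
  proof -
    have "norm (a *\<^sub>R f x + b *\<^sub>R g x) \<le> a * norm (f x) + b * norm (g x)"
      using norm_triangle_ineq[of "a *\<^sub>R f x" "b *\<^sub>R g x"] assms(3,4) by simp
    also have "\<dots> \<le> a * norm x + b * norm x"
      using assms by (intro add_mono mult_left_mono dual_ball_norm_le)
    finally show ?thesis
      using assms(5) by (simp flip: distrib_right)
  qed
  with assms(1,2) show ?thesis
    by (simp add: dual_ball_iff algebra_simps)
qed

text \<open>Banach--Alaoglu: functions carry the topology of pointwise convergence.\<close>

lemma compact_dual_ball: "compact (dual_ball smul)"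
proof -
  let ?P = "Pi\<^sub>E UNIV (\<lambda>x. cball 0 (norm x)) :: ('z \<Rightarrow> 'k) set"
  let ?L = "{f :: 'z \<Rightarrow> 'k. (\<forall>x y. f (x + y) = f x + f y) \<and> (\<forall>c x. f (smul c x) = c * f x)}"
  have "compactin (product_topology (\<lambda>_. euclidean) UNIV) ?P"
    by (simp add: compactin_PiE)
  then have "compact ?P"
    by (simp add: euclidean_product_topology)
  moreover have "closed ?L"
    by (intro closed_Collect_conj closed_Collect_all closed_Collect_eq continuous_intros
        continuous_on_product_coordinates)
  moreover have "dual_ball smul = ?P \<inter> ?L"
    by (auto simp: dual_ball_iff PiE_iff)
  ultimately show ?thesis
    by (simp add: compact_Int_closed)
qed

section \<open>The numerical range as a slice of a compact convex set\<close>

text \<open>Keeping the value at \<open>u\<close> as a coordinate allows the constraint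
  \<open>f u = 1\<close> to be reached as a limit of approximate constraints.\<close>

definition joint_values :: "'z \<Rightarrow> 'z \<Rightarrow> ('k \<times> 'k) set" where
  "joint_values u z = (\<lambda>f. (f u, f z)) ` dual_ball smul"

lemma compact_joint_values: "compact (joint_values u z)"
  unfolding joint_values_def
  by (intro compact_continuous_image compact_dual_ball continuous_intros
      continuous_on_subset[OF continuous_on_product_coordinates subset_UNIV])

lemma convex_joint_values: "convex (joint_values u z)"
proof (rule convexI)
  fix p q :: "'k \<times> 'k" and a b :: real
  assume "p \<in> joint_values u z" "q \<in> joint_values u z" and ab: "0 \<le> a" "0 \<le> b" "a + b = 1"
  then obtain f g where "f \<in> dual_ball smul" "p = (f u, f z)" "g \<in> dual_ball smul" "q = (g u, g z)"
    unfolding joint_values_def by blast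
  then show "a *\<^sub>R p + b *\<^sub>R q \<in> joint_values u z"
    unfolding joint_values_def
    by (intro image_eqI[OF _ dual_ball_convex_combination[of f g, OF _ _ ab]]) auto
qed

text \<open>Since \<open>norm u = 1\<close>, the condition \<open>f u = 1\<close> already forces
  \<open>onorm f\<close> to be at least 1, so the sphere may be replaced by the ball, which is
  convex and compact.\<close>

lemma abstract_numerical_range_iff:
  assumes "norm u = 1"
  shows "x \<in> abstract_numerical_range smul u z \<longleftrightarrow> (1, x) \<in> joint_values u z"
proof -
  have "f \<in> dual_sphere smul \<longleftrightarrow> f \<in> dual_ball smul" if "f u = 1" for f
  proof -
    have "1 \<le> onorm f" if "bounded_linear f"
      using onorm[OF that, of u] \<open>f u = 1\<close> assms by simp
    then show ?thesis
      unfolding dual_sphere_def dual_ball_def dual_space_def by force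
  qed
  then show ?thesis
    unfolding abstract_numerical_range_def joint_values_def by force
qed

section \<open>Both sets of limits equal the intersection of closures\<close>

lemma limit_values_eq:
  assumes "norm u = 1" and "\<Lambda> \<subseteq> dual_ball smul"
  shows "rotated_limit_values \<Lambda> u z = (\<Inter>\<delta>\<in>{0<..}. closure (near_values \<Lambda> u z \<delta>))"
    and "limit_values \<Lambda> u z = (\<Inter>\<delta>\<in>{0<..}. closure (near_values \<Lambda> u z \<delta>))"
proof -
  have "x \<in> rotated_limit_values \<Lambda> u z" if "x \<in> (\<Inter>\<delta>\<in>{0<..}. closure (near_values \<Lambda> u z \<delta>))" for x
  proof -
    define t where "t = (\<lambda>n. inverse (real (Suc n)))"
    have t0: "t n > 0" for n by (simp add: t_def)
    have t_lim: "t \<longlonglongrightarrow> 0" unfolding t_def by (rule LIMSEQ_inverse_real_of_nat)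
    \<comment> \<open>The same \<open>t n\<close> serves as the threshold parameter and as the
      distance to \<open>x\<close>.\<close>
    have "\<exists>\<psi>\<in>\<Lambda>. norm (\<psi> u) > 1 - t n \<and> dist (\<psi> z * rc_cnj (\<psi> u)) x < t n" for n
    proof -
      have "x \<in> closure (near_values \<Lambda> u z (t n))"
        using that t0 by auto
      then obtain y where "y \<in> near_values \<Lambda> u z (t n)" "dist y x < t n"
        using t0 by (auto simp: closure_approachable)
      then show ?thesis
        unfolding near_values_def by auto
    qed
    then obtain \<psi> where \<psi>: "\<And>n. \<psi> n \<in> \<Lambda>" "\<And>n. norm (\<psi> n u) > 1 - t n"
      "\<And>n. dist (\<psi> n z * rc_cnj (\<psi> n u)) x < t n"
      by metis
    have lim: "(\<lambda>n. \<psi> n z * rc_cnj (\<psi> n u)) \<longlonglongrightarrow> x"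
      by (rule metric_LIMSEQ_I, drule order_tendstoD(2)[OF t_lim])
        (metis \<psi>(3) eventually_sequentially less_trans)
    have bd: "norm (\<psi> n y) \<le> norm y" for n y
      using \<psi>(1) assms(2) dual_ball_norm_le by blast
    \<comment> \<open>Convergence of the products does not make the factors converge. A subsequence
      of the pairs supplies separate limits \<open>c\<close> and \<open>l\<close>.\<close>
    have "seq_compact (cball (0::'k) (norm u) \<times> cball (0::'k) (norm z))"
      by (intro compact_imp_seq_compact compact_Times compact_cball)
    then obtain c l r where r: "strict_mono (r :: nat \<Rightarrow> nat)"
      and cl: "((\<lambda>n. (\<psi> n u, \<psi> n z)) \<circ> r) \<longlonglongrightarrow> (c, l)"
      by (rule seq_compactE[where f = "\<lambda>n. (\<psi> n u, \<psi> n z)"]) (use bd in auto)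
    have c: "(\<lambda>n. \<psi> (r n) u) \<longlonglongrightarrow> c" and l: "(\<lambda>n. \<psi> (r n) z) \<longlonglongrightarrow> l"
      using tendsto_fst[OF cl] tendsto_snd[OF cl] by (simp_all add: o_def)
    have "(\<lambda>n. norm (\<psi> n u)) \<longlonglongrightarrow> 1"
    proof (rule tendsto_sandwich)
      show "\<forall>\<^sub>F n in sequentially. 1 - t n \<le> norm (\<psi> n u)"
        using \<psi>(2) by (simp add: less_imp_le)
      show "\<forall>\<^sub>F n in sequentially. norm (\<psi> n u) \<le> 1"
        using bd[of _ u] assms(1) by simp
      show "(\<lambda>n. 1 - t n) \<longlonglongrightarrow> 1"
        using tendsto_diff[OF tendsto_const t_lim] by simp
    qed simp
    from LIMSEQ_subseq_LIMSEQ[OF this r] have "norm c = 1"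
      using tendsto_norm[OF c] LIMSEQ_unique by (auto simp: o_def)
    moreover have "x = rc_cnj c * l"
      using LIMSEQ_subseq_LIMSEQ[OF lim r] tendsto_mult[OF l tendsto_rc_cnj[OF c]] LIMSEQ_unique
      by (auto simp: o_def mult.commute)
    ultimately show ?thesis
      \<comment> \<open>The rotation is \<open>rc_cnj c\<close>, because the values at
        \<open>u\<close> must tend to its conjugate.\<close>
      unfolding rotated_limit_values_def using c l \<psi>(1)
      by (intro CollectI exI[of _ "rc_cnj c"] exI[of _ l] conjI exI[of _ "\<lambda>n. \<psi> (r n)"]) auto
  qed
  then show "rotated_limit_values \<Lambda> u z = (\<Inter>\<delta>\<in>{0<..}. closure (near_values \<Lambda> u z \<delta>))"
    and "limit_values \<Lambda> u z = (\<Inter>\<delta>\<in>{0<..}. closure (near_values \<Lambda> u z \<delta>))"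
    using rotated_limit_values_subset[of \<Lambda> u z] limit_values_subset[of \<Lambda> u z] by blast+
qed

section \<open>The numerical range lies in the hull of the limit values\<close>

lemma one_norming_near_attained:
  fixes u x :: 'z
  assumes "one_norming smul \<Lambda>" and "norm u = 1" and "c < norm x"
  obtains \<psi> where "\<psi> \<in> \<Lambda>" "c < norm (\<psi> x)"
proof -
  have sup: "norm y = (SUP \<psi>\<in>\<Lambda>. norm (\<psi> y))" for y
    using assms(1) by (simp add: one_norming_def)
  \<comment> \<open>Over the empty set the supremum would be one constant, equal to both
    \<open>norm u = 1\<close> and \<open>norm 0 = 0\<close>.\<close>
  have "\<Lambda> \<noteq> {}"
    using sup[of u] sup[of 0] assms(2) by auto
  then show ?thesis
    using sup[of x] assms(3) less_cSupE[of c "(\<lambda>\<psi>. norm (\<psi> x)) ` \<Lambda>"] that by auto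
qed

text \<open>A functional nearly norming \<open>u + t *\<^sub>R w\<close> meets both estimates at
  once. The errors stay explicit in \<open>t\<close> so that both vanish along one sequence.\<close>

lemma near_attaining_functional:
  assumes "one_norming smul \<Lambda>" and "norm u = 1" and f: "f \<in> dual_ball smul" "f u = 1" and "t > 0"
  obtains \<psi> where "\<psi> \<in> \<Lambda>" "norm (\<psi> u) \<ge> 1 - t * (2 * norm w + t)"
    "inner (\<psi> u) (\<psi> w) \<ge> inner 1 (f w) - t * (1 + (norm w)\<^sup>2 / 2)"
proof -
  define r where "r = inner 1 (f w)"
  have "\<bar>r\<bar> \<le> norm w"
    unfolding r_def
    using Cauchy_Schwarz_ineq2[of 1 "f w"] dual_ball_norm_le[OF f(1), of w] by simp
  have "1 + t * r = inner 1 (f (u + t *\<^sub>R w))"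
    by (simp add: dual_ball_add[OF f(1)] dual_ball_scaleR[OF f(1)] f(2) r_def inner_add_right
        flip: power2_norm_eq_inner)
  also have "\<dots> \<le> norm (u + t *\<^sub>R w)"
    using norm_cauchy_schwarz[of 1 "f (u + t *\<^sub>R w)"] dual_ball_norm_le[OF f(1), of "u + t *\<^sub>R w"]
    by simp
  \<comment> \<open>The slack is of second order, so that dividing by \<open>t\<close> later still
    leaves an error of order \<open>t\<close>.\<close>
  finally have "1 + t * r - t\<^sup>2 < norm (u + t *\<^sub>R w)"
    using \<open>t > 0\<close> by (simp add: algebra_simps add_strict_increasing)
  then obtain \<psi> where "\<psi> \<in> \<Lambda>" and near: "1 + t * r - t\<^sup>2 < norm (\<psi> (u + t *\<^sub>R w))"
    using one_norming_near_attained[OF assms(1,2)] by metis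
  then have \<psi>: "\<psi> \<in> dual_ball smul"
    using assms(1) by (auto simp: one_norming_def)
  have expand: "\<psi> (u + t *\<^sub>R w) = \<psi> u + t *\<^sub>R \<psi> w"
    by (simp add: dual_ball_add[OF \<psi>] dual_ball_scaleR[OF \<psi>])
  have "norm (\<psi> u + t *\<^sub>R \<psi> w) \<le> norm (\<psi> u) + t * norm (\<psi> w)"
    using norm_triangle_ineq[of "\<psi> u" "t *\<^sub>R \<psi> w"] \<open>t > 0\<close> by simp
  also have "\<dots> \<le> norm (\<psi> u) + t * norm w"
    using \<open>t > 0\<close> dual_ball_norm_le[OF \<psi>, of w] by simp
  finally have "norm (\<psi> u) \<ge> 1 + t * r - t\<^sup>2 - t * norm w"
    using near expand by simp
  moreover have "t * r \<ge> - (t * norm w)"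
    using mult_left_mono[of "- norm w" r t] \<open>\<bar>r\<bar> \<le> norm w\<close> \<open>t > 0\<close> by simp
  ultimately have 1: "norm (\<psi> u) \<ge> 1 - t * (2 * norm w + t)"
    by (simp add: algebra_simps power2_eq_square)
  \<comment> \<open>Squaring \<open>near\<close> is legitimate only for a nonnegative lower bound.
    Otherwise the left-hand side is below -1 and the claim is trivial.\<close>
  have "1 + 2 * (t * r - t\<^sup>2) \<le> (norm (\<psi> u + t *\<^sub>R \<psi> w))\<^sup>2"
  proof (cases "1 + t * r - t\<^sup>2 \<ge> 0")
    case True
    then have "(1 + t * r - t\<^sup>2)\<^sup>2 \<le> (norm (\<psi> u + t *\<^sub>R \<psi> w))\<^sup>2"
      using near expand by (intro power_mono) auto
    moreover have "(1 + t * r - t\<^sup>2)\<^sup>2 = 1 + 2 * (t * r - t\<^sup>2) + (t * r - t\<^sup>2)\<^sup>2"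
      by (simp add: power2_eq_square algebra_simps)
    ultimately show ?thesis
      by (smt (verit) zero_le_power2)
  next
    case False
    then show ?thesis
      by (smt (verit) zero_le_power2)
  qed
  also have "(norm (\<psi> u + t *\<^sub>R \<psi> w))\<^sup>2
      = (norm (\<psi> u))\<^sup>2 + 2 * t * inner (\<psi> u) (\<psi> w) + t\<^sup>2 * (norm (\<psi> w))\<^sup>2"
    unfolding power2_norm_eq_inner
    by (simp add: inner_simps inner_commute power2_eq_square algebra_simps)
  also have "\<dots> \<le> 1 + 2 * t * inner (\<psi> u) (\<psi> w) + t\<^sup>2 * (norm w)\<^sup>2"
    using dual_ball_norm_le[OF \<psi>, of u] dual_ball_norm_le[OF \<psi>, of w] assms(2)
      \<open>t > 0\<close>
    by (intro add_mono mult_left_mono power_mono) (auto simp: power_le_one)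
  finally have "t * (r - t) \<le> t * (inner (\<psi> u) (\<psi> w) + t * (norm w)\<^sup>2 / 2)"
    by (simp add: algebra_simps power2_eq_square)
  then have "r - t \<le> inner (\<psi> u) (\<psi> w) + t * (norm w)\<^sup>2 / 2"
    using \<open>t > 0\<close> by simp
  then have 2: "inner (\<psi> u) (\<psi> w) \<ge> r - t * (1 + (norm w)\<^sup>2 / 2)"
    by (simp add: algebra_simps)
  show ?thesis
    using that[OF \<open>\<psi> \<in> \<Lambda>\<close> 1] 2 unfolding r_def by simp
qed

text \<open>This compares support functions in an arbitrary direction \<open>a\<close>, as
  separation requires: the limit of the near-attaining functionals as \<open>t\<close> tends to 0
  does at least as well as \<open>f\<close>.\<close>

lemma limit_values_support:
  assumes "one_norming smul \<Lambda>" and "norm u = 1" and "f \<in> dual_ball smul" "f u = 1"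
  obtains x where "x \<in> limit_values \<Lambda> u z" "inner a (f z) \<le> inner a x"
proof -
  \<comment> \<open>This multiple of \<open>z\<close> converts the direction \<open>a\<close> into
    the real-part direction, where the perturbation estimate applies.\<close>
  define w where "w = smul (rc_cnj a) z"
  have inner_w: "inner (g u) (g w) = inner a (g z * rc_cnj (g u))" if "g \<in> dual_ball smul" for g
    \<comment> \<open>Both sides equal \<open>inner (a * g u) (g z)\<close>, by two uses of the
      adjoint relation.\<close>
    using inner_mult_rc_cnj[of a "rc_cnj (g u)" "g z"] inner_mult_rc_cnj[of "g u" "rc_cnj a" "g z"]
    by (simp add: w_def dual_ball_smul[OF that] mult.commute)
  define t where "t = (\<lambda>n. inverse (real (Suc n)))"
  have t0: "t n > 0" for n by (simp add: t_def)
  have t_lim: "t \<longlonglongrightarrow> 0" unfolding t_def by (rule LIMSEQ_inverse_real_of_nat)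
  have "\<exists>\<psi>. \<psi> \<in> \<Lambda> \<and> norm (\<psi> u) \<ge> 1 - t n * (2 * norm w + t n) \<and>
      inner (\<psi> u) (\<psi> w) \<ge> inner 1 (f w) - t n * (1 + (norm w)\<^sup>2 / 2)" for n
    using near_attaining_functional[OF assms t0] by metis
  then obtain \<psi> where \<psi>: "\<And>n. \<psi> n \<in> \<Lambda>" "\<And>n. norm (\<psi> n u) \<ge> 1 - t n * (2 * norm w + t n)"
      "\<And>n. inner (\<psi> n u) (\<psi> n w) \<ge> inner 1 (f w) - t n * (1 + (norm w)\<^sup>2 / 2)"
    by metis
  have ball: "\<psi> n \<in> dual_ball smul" for n
    using \<psi>(1) assms(1) by (auto simp: one_norming_def)
  have le1: "norm (\<psi> n u) \<le> 1" for n
    using dual_ball_norm_le[OF ball, of n u] assms(2) by simp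
  have lim1: "(\<lambda>n. norm (\<psi> n u)) \<longlonglongrightarrow> 1"
  proof (rule tendsto_sandwich)
    show "\<forall>\<^sub>F n in sequentially. 1 - t n * (2 * norm w + t n) \<le> norm (\<psi> n u)"
      using \<psi>(2) by simp
    have "(\<lambda>n. 1 - t n * (2 * norm w + t n)) \<longlonglongrightarrow> 1 - 0 * (2 * norm w + 0)"
      by (intro tendsto_intros t_lim)
    then show "(\<lambda>n. 1 - t n * (2 * norm w + t n)) \<longlonglongrightarrow> 1" by simp
  qed (use le1 in auto)
  have "norm (\<psi> n z * rc_cnj (\<psi> n u)) \<le> norm z" for n
    using mult_mono[OF dual_ball_norm_le[OF ball, of n z] le1[of n]] by (simp add: norm_mult)
  then obtain x r where r: "strict_mono (r :: nat \<Rightarrow> nat)"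
    and x: "((\<lambda>n. \<psi> n z * rc_cnj (\<psi> n u)) \<circ> r) \<longlonglongrightarrow> x"
    using seq_compactE[OF compact_imp_seq_compact[OF compact_cball],
        of "\<lambda>n. \<psi> n z * rc_cnj (\<psi> n u)" 0 "norm z"]
    by (metis mem_cball_0)
  have "x \<in> limit_values \<Lambda> u z"
    unfolding limit_values_def using \<psi>(1) LIMSEQ_subseq_LIMSEQ[OF lim1 r] x
    by (intro CollectI exI[of _ "\<psi> \<circ> r"]) (simp add: o_def)
  moreover have "inner a (f z) \<le> inner a x"
  proof (rule LIMSEQ_le)
    show "(\<lambda>n. inner a (\<psi> (r n) z * rc_cnj (\<psi> (r n) u))) \<longlonglongrightarrow> inner a x"
      using tendsto_inner[OF tendsto_const x] by (simp add: o_def)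
    have "(\<lambda>n. inner 1 (f w) - t (r n) * (1 + (norm w)\<^sup>2 / 2))
        \<longlonglongrightarrow> inner 1 (f w) - 0 * (1 + (norm w)\<^sup>2 / 2)"
      using LIMSEQ_subseq_LIMSEQ[OF t_lim r] by (intro tendsto_intros) (simp add: o_def)
    moreover have "inner 1 (f w) = inner a (f z)"
      using inner_mult_rc_cnj[of 1 "rc_cnj a" "f z"]
      by (simp add: w_def dual_ball_smul[OF assms(3)])
    ultimately show "(\<lambda>n. inner 1 (f w) - t (r n) * (1 + (norm w)\<^sup>2 / 2)) \<longlonglongrightarrow> inner a (f z)"
      by simp
    show "\<exists>N. \<forall>n\<ge>N. inner 1 (f w) - t (r n) * (1 + (norm w)\<^sup>2 / 2)
        \<le> inner a (\<psi> (r n) z * rc_cnj (\<psi> (r n) u))"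
      using \<psi>(3) inner_w[OF ball] by auto
  qed
  ultimately show ?thesis using that by blast
qed

lemma compact_Inter_near_values:
  assumes "norm u = 1" and "\<Lambda> \<subseteq> dual_ball smul"
  shows "compact (\<Inter>\<delta>\<in>{0<..}. closure (near_values \<Lambda> u z \<delta>))"
proof -
  have "near_values \<Lambda> u z 1 \<subseteq> cball 0 (norm z)"
  proof
    fix y
    assume "y \<in> near_values \<Lambda> u z 1"
    then obtain \<psi> where y: "y = \<psi> z * rc_cnj (\<psi> u)" and "\<psi> \<in> dual_ball smul"
      using assms(2) by (auto simp: near_values_def)
    then have "norm (\<psi> z) * norm (\<psi> u) \<le> norm z * 1"
      using assms(1) dual_ball_norm_le by (intro mult_mono) (auto dest: dual_ball_norm_le[of _ u])
    then show "y \<in> cball 0 (norm z)"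
      by (simp add: y norm_mult)
  qed
  then have "compact (closure (near_values \<Lambda> u z 1))"
    using bounded_subset[OF bounded_cball] compact_closure by blast
  then show ?thesis
    \<comment> \<open>The whole intersection is closed and lies in the compact member with parameter
      1.\<close>
    by (rule compact_Int_closed[of _ "\<Inter>\<delta>\<in>{0<..}. closure (near_values \<Lambda> u z \<delta>)",
          THEN back_subst[of compact]]) auto
qed

text \<open>In finite dimension the hull of a compact set is closed, so a point outside it can be
  strictly separated.\<close>

lemma abstract_numerical_range_subset:
  assumes "one_norming smul \<Lambda>" and "norm u = 1"
  shows "abstract_numerical_range smul u z
    \<subseteq> convex hull (\<Inter>\<delta>\<in>{0<..}. closure (near_values \<Lambda> u z \<delta>))" (is "_ \<subseteq> convex hull ?A")
proof
  fix v
  assume "v \<in> abstract_numerical_range smul u z"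
  then obtain f where f: "f \<in> dual_ball smul" "f u = 1" "v = f z"
    using abstract_numerical_range_iff[OF assms(2)] by (auto simp: joint_values_def)
  have \<Lambda>: "\<Lambda> \<subseteq> dual_ball smul"
    using assms(1) by (simp add: one_norming_def)
  show "v \<in> convex hull ?A"
  proof (rule ccontr)
    assume "v \<notin> convex hull ?A"
    moreover have "closed (convex hull ?A)"
      by (intro compact_imp_closed compact_convex_hull compact_Inter_near_values assms(2) \<Lambda>)
    ultimately obtain a b where ab: "inner a v < b" "\<forall>x\<in>convex hull ?A. inner a x > b"
      using separating_hyperplane_closed_point[OF convex_convex_hull] by metis
    \<comment> \<open>The separation puts the hull on the upper side of \<open>v\<close>, hence the
      direction \<open>- a\<close>.\<close>
    obtain x where "x \<in> limit_values \<Lambda> u z" "inner (- a) (f z) \<le> inner (- a) x"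
      using limit_values_support[OF assms f(1,2)] by metis
    moreover from this have "x \<in> convex hull ?A"
      using limit_values_eq(2)[OF assms(2) \<Lambda>] hull_subset[of ?A convex] by blast
    ultimately show False
      using ab f(3) by fastforce
  qed
qed

section \<open>The intersection of hulls lies in the numerical range\<close>

lemma near_values_subset_joint_values:
  assumes "norm u = 1" and "\<Lambda> \<subseteq> dual_ball smul" and "0 < \<delta>" "\<delta> \<le> 1"
  shows "near_values \<Lambda> u z \<delta> \<subseteq> snd ` (joint_values u z \<inter> cball 1 (2 * \<delta>) \<times> UNIV)"
proof
  fix y
  assume "y \<in> near_values \<Lambda> u z \<delta>"
  then obtain \<psi> where y: "y = \<psi> z * rc_cnj (\<psi> u)" and \<psi>: "\<psi> \<in> dual_ball smul"
    and near: "norm (\<psi> u) > 1 - \<delta>"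
    using assms(2) by (auto simp: near_values_def)
  \<comment> \<open>This rotation and scaling makes the value at \<open>u\<close> the real number
    \<open>(norm (\<psi> u))\<^sup>2\<close>, while the value at \<open>z\<close> is exactly
    \<open>y\<close>.\<close>
  define g where "g = (\<lambda>x. rc_cnj (\<psi> u) * \<psi> x)"
  have le1: "norm (\<psi> u) \<le> 1"
    using dual_ball_norm_le[OF \<psi>, of u] assms(1) by simp
  then have g: "g \<in> dual_ball smul"
    unfolding g_def by (intro dual_ball_scaled[OF \<psi>]) simp
  have "g u = ((norm (\<psi> u))\<^sup>2) *\<^sub>R 1"
    by (simp add: g_def mult.commute rc_mult_cnj)
  then have "1 - g u = (1 - (norm (\<psi> u))\<^sup>2) *\<^sub>R 1"
    by (simp add: scaleR_diff_left)
  then have "dist 1 (g u) = \<bar>1 - (norm (\<psi> u))\<^sup>2\<bar>"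
    by (simp add: dist_norm)
  also have "\<dots> = 1 - (norm (\<psi> u))\<^sup>2"
    using le1 by (simp add: power_le_one)
  also have "\<dots> \<le> 2 * \<delta>"
  proof -
    \<comment> \<open>The bound \<open>\<delta> \<le> 1\<close> keeps \<open>1 - \<delta>\<close>
      nonnegative, so squaring preserves the inequality.\<close>
    have "(1 - \<delta>)\<^sup>2 \<le> (norm (\<psi> u))\<^sup>2"
      using near assms(4) by (intro power_mono) auto
    moreover have "(1 - \<delta>)\<^sup>2 = 1 - 2 * \<delta> + \<delta>\<^sup>2"
      by (simp add: power2_eq_square algebra_simps)
    ultimately show ?thesis
      by (smt (verit) zero_le_power2)
  qed
  finally show "y \<in> snd ` (joint_values u z \<inter> cball 1 (2 * \<delta>) \<times> UNIV)"
    using g by (intro image_eqI[of _ _ "(g u, g z)"]) (auto simp: joint_values_def y g_def mult.commute)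
qed

text \<open>The set \<open>?C\<close> of second coordinates is compact and convex, so it absorbs
  both the closure and the hull of \<open>near_values\<close>. Thus \<open>y\<close> pairs with
  first coordinates arbitrarily near 1, and closedness of \<open>joint_values\<close> gives the pair
  with 1 itself.\<close>

lemma Inter_hull_subset_abstract_numerical_range:
  assumes "norm u = 1" and "\<Lambda> \<subseteq> dual_ball smul"
  shows "(\<Inter>\<delta>\<in>{0<..}. convex hull closure (near_values \<Lambda> u z \<delta>))
    \<subseteq> abstract_numerical_range smul u z"
proof
  fix y
  assume y: "y \<in> (\<Inter>\<delta>\<in>{0<..}. convex hull closure (near_values \<Lambda> u z \<delta>))"
  have "(1, y) \<in> closure (joint_values u z)"
    unfolding closure_approachable
  proof (intro allI impI)
    fix e :: real
    assume "e > 0"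
    \<comment> \<open>The quarter brings \<open>2 * \<delta>\<close> strictly below
      \<open>e\<close>, and the cap at 1 meets the hypothesis of
      \<open>near_values_subset_joint_values\<close>.\<close>
    define \<delta> where "\<delta> = min 1 (e / 4)"
    have \<delta>: "0 < \<delta>" "\<delta> \<le> 1" "2 * \<delta> < e"
      using \<open>e > 0\<close> by (auto simp: \<delta>_def)
    let ?C = "snd ` (joint_values u z \<inter> cball 1 (2 * \<delta>) \<times> UNIV)"
    have "compact ?C"
      by (intro compact_continuous_image continuous_intros compact_Int_closed compact_joint_values
          closed_Times closed_cball closed_UNIV)
    moreover have "convex ?C"
      by (intro convex_linear_image linear_snd convex_Int convex_joint_values convex_Times
          convex_cball convex_UNIV)
    ultimately have "convex hull closure (near_values \<Lambda> u z \<delta>) \<subseteq> ?C"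
      using near_values_subset_joint_values[OF assms \<delta>(1,2)]
      by (intro hull_minimal closure_minimal compact_imp_closed)
    moreover have "y \<in> convex hull closure (near_values \<Lambda> u z \<delta>)"
      using y \<delta>(1) by blast
    ultimately obtain c where "(c, y) \<in> joint_values u z" "dist 1 c \<le> 2 * \<delta>"
      by auto
    then show "\<exists>p\<in>joint_values u z. dist p (1, y) < e"
      using \<delta>(3) by (intro bexI[of _ "(c, y)"]) (auto simp: dist_Pair_Pair dist_commute)
  qed
  then show "y \<in> abstract_numerical_range smul u z"
    using abstract_numerical_range_iff[OF assms(1)] compact_joint_values[of u z]
    by (simp add: compact_imp_closed closure_closed)
qed

end

theorem theorem2p4:
  fixes smul :: "'k::rc_field \<Rightarrow> 'z::banach \<Rightarrow> 'z"
    and u z :: 'z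
    and \<Lambda> :: "('z \<Rightarrow> 'k) set"
  assumes "banach_over smul"
    and "norm u = 1"
    and "one_norming smul \<Lambda>"
  shows "abstract_numerical_range smul u z =
           convex hull {\<theta> * l |\<theta> l. norm \<theta> = 1 \<and>
             (\<exists>\<psi>::nat \<Rightarrow> 'z \<Rightarrow> 'k. (\<forall>n. \<psi> n \<in> \<Lambda>) \<and>
               (\<lambda>n. \<psi> n u) \<longlonglongrightarrow> rc_cnj \<theta> \<and> (\<lambda>n. \<psi> n z) \<longlonglongrightarrow> l)}
       \<and> abstract_numerical_range smul u z =
           convex hull {l. \<exists>\<psi>::nat \<Rightarrow> 'z \<Rightarrow> 'k. (\<forall>n. \<psi> n \<in> \<Lambda>) \<and>
               (\<lambda>n. norm (\<psi> n u)) \<longlonglongrightarrow> 1 \<and> (\<lambda>n. \<psi> n z * rc_cnj (\<psi> n u)) \<longlonglongrightarrow> l}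
       \<and> abstract_numerical_range smul u z =
           convex hull (\<Inter>\<delta>\<in>{0<..}.
             closure {\<psi> z * rc_cnj (\<psi> u) |\<psi>. \<psi> \<in> \<Lambda> \<and> norm (\<psi> u) > 1 - \<delta>})
       \<and> abstract_numerical_range smul u z =
           (\<Inter>\<delta>\<in>{0<..}. convex hull
             closure {\<psi> z * rc_cnj (\<psi> u) |\<psi>. \<psi> \<in> \<Lambda> \<and> norm (\<psi> u) > 1 - \<delta>})"
proof -
  interpret banach_over smul by (rule assms(1))
  have \<Lambda>: "\<Lambda> \<subseteq> dual_ball smul"
    using assms(3) by (simp add: one_norming_def)
  let ?A = "\<Inter>\<delta>\<in>{0<..}. closure (near_values \<Lambda> u z \<delta>)"
  let ?H = "\<Inter>\<delta>\<in>{0<..}. convex hull closure (near_values \<Lambda> u z \<delta>)"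
  have "convex hull ?A \<subseteq> ?H"
    by (intro INT_greatest hull_mono) blast
  with abstract_numerical_range_subset[OF assms(3,2), of z]
    Inter_hull_subset_abstract_numerical_range[OF assms(2) \<Lambda>, of z]
  have "abstract_numerical_range smul u z = convex hull ?A" "abstract_numerical_range smul u z = ?H"
    by blast+
  moreover have "rotated_limit_values \<Lambda> u z = ?A" "limit_values \<Lambda> u z = ?A"
    by (rule limit_values_eq[OF assms(2) \<Lambda>])+
  ultimately show ?thesis
    unfolding rotated_limit_values_def limit_values_def near_values_def by simp
qed

end
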